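(* Let $\mathbf{A}=(a_{j,k})$ be the $N\times N$ propagation matrix with entries $$a_{j,k}=\frac{\mu^{(k)}}{\sum_{\ell\in\mathcal{L}^{(j)}}(\lambda^{(\ell)}+\mu^{(\ell)})}\,\mathbf{1}_{\{k\in\mathcal{L}^{(j)}\}}.$$ Then its spectral radius satisfies $\rho(\mathbf{A})\le 1$. Moreover, the strict inequality $\rho(\mathbf{A})<1$ holds in each of the following two cases: (cs1) $\lambda^{(n)}>0$ for all $n\in\mathcal{N}$; (cs2) for every (directed) cycle in the Leader-graph, at least one user participating in the cycle has a leader $k$ with positive self-post rate $\lambda^{(k)}>0$.
   Context: $\mathcal{N}=\{1,\dots,N\}$ is a finite set of users. Each user $n$ has a nonempty set of leaders $\mathcal{L}^{(n)}\subseteq\mathcal{N}\setminus\{n\}$, a self-post rate $\lambda^{(n)}\ge0$ and a re-post rate $\mu^{(n)}\ge0$, with $\lambda^{(n)}+\mu^{(n)}>0$. The Leader-graph is the directed graph on $\mathcal{N}$ with an edge from $i$ to $j$ exactly when $i\in\mathcal{L}^{(j)}$. $\rho(\cdot)$ denotes the spectral radius. *)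

theory Defs
  imports
    "Jordan_Normal_Form.Spectral_Radius"
    "Graph_Theory.Graph_Theory"
begin

definition leader_graph :: "nat \<Rightarrow> (nat \<Rightarrow> nat set) \<Rightarrow> (nat, nat \<times> nat) pre_digraph" where
  "leader_graph N L =
     \<lparr>verts = {1..N},
      arcs = {(i, j). i \<in> {1..N} \<and> j \<in> {1..N} \<and> i \<in> L j},
      tail = fst,
      head = snd\<rparr>"

definition propagation_entry ::
    "(nat \<Rightarrow> nat set) \<Rightarrow> (nat \<Rightarrow> real) \<Rightarrow> (nat \<Rightarrow> real) \<Rightarrow> nat \<Rightarrow> nat \<Rightarrow> real" where
  "propagation_entry L lam mu j k =
     mu k / (\<Sum>l\<in>L j. lam l + mu l) * of_bool (k \<in> L j)"

text \<open>Matrix indices start at 0 whereas users are numbered from 1: row \<open>i\<close> belongs to user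
  \<open>Suc i\<close>.\<close>

definition propagation_matrix ::
    "nat \<Rightarrow> (nat \<Rightarrow> nat set) \<Rightarrow> (nat \<Rightarrow> real) \<Rightarrow> (nat \<Rightarrow> real) \<Rightarrow> real mat" where
  "propagation_matrix N L lam mu =
     mat N N (\<lambda>(i, i'). propagation_entry L lam mu (Suc i) (Suc i'))"

text \<open>The spectral radius of a real matrix is taken over its complex eigenvalues.\<close>

definition real_spectral_radius :: "real mat \<Rightarrow> real" where
  "real_spectral_radius A = spectral_radius (map_mat complex_of_real A)"

text \<open>If \<open>p\<close> is a cycle, \<open>u\<close> is determined by \<open>p\<close> as its base point, and
  \<open>awalk_verts u p\<close> lists the users on the cycle.\<close>

definition cycles_have_posting_leader :: "nat \<Rightarrow> (nat \<Rightarrow> nat set) \<Rightarrow> (nat \<Rightarrow> real) \<Rightarrow> bool" where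
  "cycles_have_posting_leader N L lam \<longleftrightarrow>
     (\<forall>u p. pre_digraph.cycle (leader_graph N L) p \<and>
            pre_digraph.awalk (leader_graph N L) u p u \<longrightarrow>
        (\<exists>n\<in>set (pre_digraph.awalk_verts (leader_graph N L) u p). \<exists>k\<in>L n. lam k > 0))"

end

theory Submission
  imports Defs
begin

text \<open>
  Let \<open>z\<close> be an eigenvalue with eigenvector \<open>v\<close>, and let \<open>j\<close> be a user at which \<open>\<bar>v\<bar>\<close> is maximal.
  Row \<open>j\<close> is nonnegative with sum at most 1, so \<open>\<bar>z\<bar> \<le> 1\<close>. If \<open>\<bar>z\<bar> = 1\<close>, equality holds
  throughout: all leaders of \<open>j\<close> have self-post rate 0, hence positive weight in row \<open>j\<close>, hence
  they are maximisers too. The set of maximisers is therefore closed under taking leaders and so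
  contains a cycle, none of whose users has a leader with positive self-post rate.
\<close>

text \<open>A discrete maximum principle. Bounding each \<open>x k\<close> by \<open>m\<close> gives
  r m \<le> (sum of the weights) m \<le> m, and \<open>m\<close> cancels because it is positive. For
  r \<ge> 1 the chain collapses: the weights have total exactly 1, and no term of positive weight
  can stay below \<open>m\<close>.\<close>

lemma submean_at_max:
  fixes w x :: "'a \<Rightarrow> real"
  assumes w: "\<And>k. k \<in> A \<Longrightarrow> 0 \<le> w k" "sum w A \<le> 1"
    and x: "\<And>k. k \<in> A \<Longrightarrow> x k \<le> m" and "0 < m"
    and le: "r * m \<le> (\<Sum>k\<in>A. w k * x k)"
  shows submean_at_max_le: "r \<le> 1"
    and submean_at_max_sum: "1 \<le> r \<Longrightarrow> sum w A = 1"
    and submean_at_max_eq: "1 \<le> r \<Longrightarrow> finite A \<Longrightarrow> k \<in> A \<Longrightarrow> 0 < w k \<Longrightarrow> x k = m"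
proof -
  have up: "(\<Sum>k\<in>A. w k * x k) \<le> sum w A * m"
    unfolding sum_distrib_right by (intro sum_mono mult_left_mono w x)
  from le up have "r * m \<le> sum w A * m" by linarith
  with \<open>0 < m\<close> have r: "r \<le> sum w A" by simp
  with w(2) show "r \<le> 1" by simp
  assume "1 \<le> r"
  with r w(2) show one: "sum w A = 1" by simp
  assume "finite A" "k \<in> A" "0 < w k"
  \<comment> \<open>From m \<le> r m \<le> weighted sum \<le> m all terms are equal, so the
    nonnegative deficits \<open>w k * (m - x k)\<close> add up to zero and each of them
    vanishes.\<close>
  have "m \<le> r * m" using \<open>1 \<le> r\<close> \<open>0 < m\<close> by simp
  with le up one have "(\<Sum>k\<in>A. w k * x k) = (\<Sum>k\<in>A. w k * m)"
    by (simp add: sum_distrib_right [symmetric])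
  then have "(\<Sum>k\<in>A. w k * (m - x k)) = 0"
    by (simp add: right_diff_distrib sum_subtractf)
  moreover have "\<And>k. k \<in> A \<Longrightarrow> 0 \<le> w k * (m - x k)"
    using w(1) x by simp
  ultimately have "w k * (m - x k) = 0"
    using \<open>finite A\<close> \<open>k \<in> A\<close> by (simp add: sum_nonneg_eq_0_iff)
  with \<open>0 < w k\<close> show "x k = m" by simp
qed

text \<open>Following arcs backwards never leaves \<open>S\<close> and never has to stop, so the arc
  relation on \<open>S\<close> is not well-founded; being finite, it cannot be acyclic. Passing to
  the induced subgraph keeps the resulting cycle inside \<open>S\<close>.\<close>

lemma (in wf_digraph) predecessor_closed_imp_cycle:
  assumes S: "finite S" "S \<noteq> {}" "S \<subseteq> verts G"
    and pred: "\<And>v. v \<in> S \<Longrightarrow> \<exists>e\<in>arcs G. head G e = v \<and> tail G e \<in> S"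
  shows "\<exists>u p. cycle p \<and> awalk u p u \<and> set (awalk_verts u p) \<subseteq> S"
proof -
  let ?H = "induce_subgraph G S"
  interpret H: wf_digraph ?H ..
  have sub: "subgraph ?H G" using S(3) by (intro induced_imp_subgraph induced_induce)
  have "H.cycle p \<Longrightarrow> ?thesis" for p
  proof -
    assume "H.cycle p"
    then obtain u where u: "H.awalk u p u" by (auto simp: H.cycle_def)
    from \<open>H.cycle p\<close> have "cycle p"
      by (rule subgraph_cycle[OF sub])
    moreover have "awalk u p u"
      using u by (rule subgraph_awalk_imp_awalk[OF _ sub])
    \<comment> \<open>Both graphs share \<open>tail\<close> and \<open>head\<close>, so a walk
      visits the same vertices in either.\<close>
    moreover have "set (awalk_verts u p) \<subseteq> S"
      using u by (auto simp: H.awalk_conv compatible_awalk_verts[OF compatible_induce_subgraph])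
    ultimately show ?thesis by blast
  qed
  moreover have "\<exists>p. H.cycle p"
  proof -
    have ends: "arcs_ends ?H \<subseteq> S \<times> S"
      by (auto simp: arcs_ends_def arc_to_ends_def)
    have "\<not> wf (arcs_ends ?H)"
    proof
      assume "wf (arcs_ends ?H)"
      with S(2) obtain v where v: "v \<in> S" "\<And>y. (y, v) \<in> arcs_ends ?H \<Longrightarrow> y \<notin> S"
        using wfE_min[of "arcs_ends ?H" _ S] by blast
      from pred[OF v(1)] obtain e where "e \<in> arcs G" "head G e = v" "tail G e \<in> S"
        by blast
      with v(1) have "(tail G e, v) \<in> arcs_ends ?H"
        by (auto simp: arcs_ends_def arc_to_ends_def)
      from v(2)[OF this] \<open>tail G e \<in> S\<close> show False by contradiction
    qed
    \<comment> \<open>The arc set itself may be infinite because of parallel arcs; the set of end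
      pairs lies in \<open>S \<times> S\<close>.\<close>
    moreover have "finite (arcs_ends ?H)"
      using ends S(1) by (blast intro: finite_subset)
    ultimately have "\<not> acyclic (arcs_ends ?H)"
      by (blast intro: finite_acyclic_wf)
    then obtain u where "(u, u) \<in> (arcs_ends ?H)\<^sup>+" by (auto simp: acyclic_def)
    then obtain p where "H.awalk u p u" "p \<noteq> []" by (auto simp: H.reachable1_awalk)
    then have "H.closed_w p" by (auto simp: H.closed_w_def)
    then show ?thesis by (rule H.closed_w_imp_cycle)
  qed
  ultimately show ?thesis by blast
qed

lemma wf_digraph_leader_graph: "wf_digraph (leader_graph N L)"
  by unfold_locales (auto simp: leader_graph_def)

text \<open>Entries of row \<open>j\<close> outside \<open>L j\<close> carry a zero indicator, so
  only leaders contribute. The equation is put in terms of users, numbered from 1, so that later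
  arguments can work on \<open>L j\<close> directly.\<close>

lemma propagation_eigenvector:
  assumes ev: "eigenvector (map_mat complex_of_real (propagation_matrix N L lam mu)) v z"
    and j: "j \<in> {1..N}" and L: "L j \<subseteq> {1..N}"
  shows "z * v $ (j - 1) = (\<Sum>k\<in>L j. of_real (propagation_entry L lam mu j k) * v $ (k - 1))"
proof -
  let ?A = "map_mat complex_of_real (propagation_matrix N L lam mu)"
  have v: "dim_vec v = N" and Av: "?A *\<^sub>v v = z \<cdot>\<^sub>v v"
    using ev by (auto simp: eigenvector_def propagation_matrix_def)
  have jj: "j - 1 < N" "Suc (j - 1) = j" using j by auto
  have "z * v $ (j - 1) = (?A *\<^sub>v v) $ (j - 1)"
    using v jj by (simp add: Av)
  also have "\<dots> = (\<Sum>i<N. of_real (propagation_entry L lam mu j (Suc i)) * v $ i)"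
    using v jj by (simp add: propagation_matrix_def scalar_prod_def lessThan_atLeast0)
  also have "\<dots> = (\<Sum>k\<in>{1..N}. of_real (propagation_entry L lam mu j k) * v $ (k - 1))"
    by (rule sum.reindex_bij_witness[of _ "\<lambda>k. k - 1" Suc]) auto
  also have "\<dots> = (\<Sum>k\<in>L j. of_real (propagation_entry L lam mu j k) * v $ (k - 1))"
    using L by (intro sum.mono_neutral_right) (auto simp: propagation_entry_def)
  finally show ?thesis .
qed

text \<open>The row sum is the total re-post rate of the leaders divided by their total rate, so its
  gap to 1 is exactly the share of self-posts. A leader with zero self-post rate has a positive
  re-post rate, hence a positive entry.\<close>

lemma propagation_row:
  assumes fin: "finite (L j)" and ne: "L j \<noteq> {}"
    and nonneg: "\<And>k. k \<in> L j \<Longrightarrow> 0 \<le> lam k" "\<And>k. k \<in> L j \<Longrightarrow> 0 \<le> mu k"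
    and pos: "\<And>k. k \<in> L j \<Longrightarrow> 0 < lam k + mu k"
  shows propagation_entry_nonneg: "k \<in> L j \<Longrightarrow> 0 \<le> propagation_entry L lam mu j k"
    and propagation_entry_pos:
      "k \<in> L j \<Longrightarrow> lam k = 0 \<Longrightarrow> 0 < propagation_entry L lam mu j k"
    and propagation_row_sum_le: "(\<Sum>k\<in>L j. propagation_entry L lam mu j k) \<le> 1"
    and propagation_row_sum_eq_1_iff:
      "(\<Sum>k\<in>L j. propagation_entry L lam mu j k) = 1 \<longleftrightarrow> (\<forall>k\<in>L j. lam k = 0)"
proof -
  let ?s = "\<Sum>l\<in>L j. lam l + mu l"
  have s: "0 < ?s" using fin ne pos by (rule sum_pos)
  show "k \<in> L j \<Longrightarrow> 0 \<le> propagation_entry L lam mu j k"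
    using nonneg s by (simp add: propagation_entry_def)
  show "k \<in> L j \<Longrightarrow> lam k = 0 \<Longrightarrow> 0 < propagation_entry L lam mu j k"
    using pos[of k] s by (simp add: propagation_entry_def)
  have eq: "(\<Sum>k\<in>L j. propagation_entry L lam mu j k) = sum mu (L j) / ?s"
    by (simp add: propagation_entry_def sum_divide_distrib)
  have s_eq: "?s = sum lam (L j) + sum mu (L j)" by (rule sum.distrib)
  have lam: "0 \<le> sum lam (L j)" using nonneg(1) by (rule sum_nonneg)
  show "(\<Sum>k\<in>L j. propagation_entry L lam mu j k) \<le> 1"
    unfolding eq using s lam s_eq by simp
  have "(\<Sum>k\<in>L j. propagation_entry L lam mu j k) = 1 \<longleftrightarrow> sum lam (L j) = 0"
    unfolding eq using s s_eq by simp
  also have "\<dots> \<longleftrightarrow> (\<forall>k\<in>L j. lam k = 0)"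
    using fin nonneg(1) by (simp add: sum_nonneg_eq_0_iff)
  finally show "(\<Sum>k\<in>L j. propagation_entry L lam mu j k) = 1 \<longleftrightarrow> (\<forall>k\<in>L j. lam k = 0)" .
qed

theorem lemma2:
  fixes N :: nat
    and L :: "nat \<Rightarrow> nat set"
    and lam mu :: "nat \<Rightarrow> real"
  assumes "N \<ge> 1"
    and "\<And>n. n \<in> {1..N} \<Longrightarrow> L n \<noteq> {}"
    and "\<And>n. n \<in> {1..N} \<Longrightarrow> L n \<subseteq> {1..N} - {n}"
    and "\<And>n. n \<in> {1..N} \<Longrightarrow> lam n \<ge> 0"
    and "\<And>n. n \<in> {1..N} \<Longrightarrow> mu n \<ge> 0"
    and "\<And>n. n \<in> {1..N} \<Longrightarrow> lam n + mu n > 0"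
  shows "real_spectral_radius (propagation_matrix N L lam mu) \<le> 1 \<and>
         ((\<forall>n\<in>{1..N}. lam n > 0) \<longrightarrow>
            real_spectral_radius (propagation_matrix N L lam mu) < 1) \<and>
         (cycles_have_posting_leader N L lam \<longrightarrow>
            real_spectral_radius (propagation_matrix N L lam mu) < 1)"
proof -
  let ?A = "map_mat complex_of_real (propagation_matrix N L lam mu)"
  let ?w = "propagation_entry L lam mu"
  interpret G: wf_digraph "leader_graph N L" by (rule wf_digraph_leader_graph)
  have "?A \<in> carrier_mat N N" by (simp add: propagation_matrix_def)
  \<comment> \<open>The spectrum is nonempty because N \<ge> 1, so the maximum modulus is
    attained.\<close>
  from spectral_radius_mem_max(1)[OF this] assms(1)
  obtain z where z: "real_spectral_radius (propagation_matrix N L lam mu) = norm z"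
    and "eigenvalue ?A z"
    by (auto simp: real_spectral_radius_def spectrum_def)
  then obtain v where v: "eigenvector ?A v z" by (auto simp: eigenvalue_def)
  define x where "x k = norm (v $ (k - 1))" for k
  define m where "m = Max (x ` {1..N})"
  define S where "S = {k \<in> {1..N}. x k = m}"
  have L: "L j \<subseteq> {1..N}" "finite (L j)" if "j \<in> {1..N}" for j
    using assms(3)[OF that] by (auto intro: finite_subset)
  have x_le: "x k \<le> m" if "k \<in> {1..N}" for k
    unfolding m_def using that by simp
  have "m \<in> x ` {1..N}"
    unfolding m_def using assms(1) by (intro Max_in) auto
  then have "S \<noteq> {}" by (auto simp: S_def)
  have "0 < m"
  proof -
    have "dim_vec v = N" "v \<noteq> 0\<^sub>v N"
      using v by (auto simp: eigenvector_def propagation_matrix_def)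
    then obtain i where i: "i < N" "v $ i \<noteq> 0" by (metis eq_vecI index_zero_vec)
    then have "0 < x (Suc i)" by (simp add: x_def)
    also have "\<dots> \<le> m" using i by (intro x_le) auto
    finally show ?thesis .
  qed
  \<comment> \<open>The triangle inequality turns the complex eigenvector equation at a maximiser
    into a real inequality between moduli.\<close>
  have step: "norm z * m \<le> (\<Sum>k\<in>L j. ?w j k * x k)" if "j \<in> S" for j
  proof -
    have j: "j \<in> {1..N}" "x j = m" using that by (auto simp: S_def)
    have "norm z * m = norm (z * v $ (j - 1))"
      using j by (simp add: x_def norm_mult)
    also have "\<dots> \<le> (\<Sum>k\<in>L j. norm (of_real (?w j k) * v $ (k - 1)))"
      unfolding propagation_eigenvector[OF v j(1) L(1)[OF j(1)]] by (rule norm_sum)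
    also have "\<dots> = (\<Sum>k\<in>L j. ?w j k * x k)"
    proof (rule sum.cong)
      fix k assume "k \<in> L j"
      then have "0 \<le> ?w j k"
        using L[OF j(1)] assms(2)[OF j(1)] assms(4-6)
        by (intro propagation_entry_nonneg) auto
      then show "norm (of_real (?w j k) * v $ (k - 1)) = ?w j k * x k"
        by (simp add: x_def norm_mult)
    qed simp
    finally show ?thesis .
  qed
  have at_max: "norm z \<le> 1"
    and closed: "1 \<le> norm z \<Longrightarrow> L j \<subseteq> S \<and> (\<forall>k\<in>L j. lam k = 0)" if jS: "j \<in> S" for j
  proof -
    have j: "j \<in> {1..N}" using jS by (simp add: S_def)
    have Lj: "k \<in> {1..N}" if "k \<in> L j" for k using L(1)[OF j] that by auto
    note row = L(2)[OF j] assms(2)[OF j] assms(4)[OF Lj] assms(5)[OF Lj] assms(6)[OF Lj]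
    \<comment> \<open>The premises of \<open>submean_at_max\<close> for the leaders of
      \<open>j\<close>, with r = \<open>norm z\<close>.\<close>
    note avg = propagation_entry_nonneg[of L j, OF row] propagation_row_sum_le[of L j, OF row]
      x_le[OF Lj] \<open>0 < m\<close> step[OF jS]
    show "norm z \<le> 1" by (rule submean_at_max_le[OF avg])
    assume 1: "1 \<le> norm z"
    have lam: "\<forall>k\<in>L j. lam k = 0"
      using submean_at_max_sum[OF avg 1] propagation_row_sum_eq_1_iff[of L j, OF row] by simp
    \<comment> \<open>With zero self-post rates every leader has positive weight, so equality passes
      from \<open>j\<close> to all of \<open>L j\<close>.\<close>
    have "x k = m" if "k \<in> L j" for k
      using submean_at_max_eq[OF avg 1 L(2)[OF j] that]
        propagation_entry_pos[of L j, OF row that] lam that by simp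
    with Lj lam show "L j \<subseteq> S \<and> (\<forall>k\<in>L j. lam k = 0)" by (auto simp: S_def)
  qed
  have "norm z \<le> 1" using at_max \<open>S \<noteq> {}\<close> by auto
  moreover have "norm z < 1" if pos: "\<forall>n\<in>{1..N}. lam n > 0"
  proof (rule ccontr)
    assume "\<not> norm z < 1"
    moreover obtain j where j: "j \<in> S" using \<open>S \<noteq> {}\<close> by auto
    \<comment> \<open>One leader of one maximiser suffices: its self-post rate would be 0.\<close>
    moreover obtain k where "k \<in> L j" using assms(2)[of j] j by (auto simp: S_def)
    ultimately have "k \<in> {1..N}" "lam k = 0" using closed[of j] by (auto simp: S_def)
    with pos show False by fastforce
  qed
  moreover have "norm z < 1" if cyc: "cycles_have_posting_leader N L lam"
  proof (rule ccontr)
    assume "\<not> norm z < 1"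
    then have *: "L j \<subseteq> S" "\<forall>k\<in>L j. lam k = 0" if "j \<in> S" for j
      using closed[OF that] by auto
    have "\<exists>e\<in>arcs (leader_graph N L). head (leader_graph N L) e = j \<and>
        tail (leader_graph N L) e \<in> S" if "j \<in> S" for j
    proof -
      \<comment> \<open>Arcs run from leader to follower, so closure under leaders supplies
        predecessors within \<open>S\<close>.\<close>
      obtain k where "k \<in> L j" using assms(2)[of j] \<open>j \<in> S\<close> by (auto simp: S_def)
      then show ?thesis using *(1)[OF that] that
        by (intro bexI[of _ "(k, j)"]) (auto simp: leader_graph_def S_def)
    qed
    moreover have "finite S" "S \<subseteq> verts (leader_graph N L)"
      by (auto simp: S_def leader_graph_def)
    ultimately obtain u p where up: "G.cycle p" "G.awalk u p u" and in_S: "set (G.awalk_verts u p) \<subseteq> S"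
      using G.predecessor_closed_imp_cycle[of S] \<open>S \<noteq> {}\<close> by auto
    from cyc up obtain n k where "n \<in> set (G.awalk_verts u p)" "k \<in> L n" "lam k > 0"
      unfolding cycles_have_posting_leader_def by blast
    with in_S *(2)[of n] show False by auto
  qed
  ultimately show ?thesis unfolding z by blast
qed

end
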